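(* Let $A$, $B$ and $B'$ be matrices in $\mathbb{C}^{d\times d}$. Then the matrix function $$G_1(A,B,B';x,y)=\sum_{m,n=0}^{\infty}(A)_{m+n}(B)_{n-m}(B')_{m-n}\frac{x^m y^n}{m!\,n!}$$ converges absolutely for $r+s<1$, $|x|\le r$, $|y|\le s$.
   Context: Here $x,y$ are complex variables and $r,s$ are real numbers. Matrix Pochhammer symbol: for $M\in\mathbb{C}^{d\times d}$, $(M)_0=I$, $(M)_n=M(M+I)\cdots(M+(n-1)I)$ for $n\ge1$, and for negative indices $(M)_{-n}=(-1)^n(I-M)_n^{-1}$. *)

theory Defs
  imports "HOL-Analysis.Analysis"
begin

(* Square complex matrices are complex^'d^'d with product **; mat c is the scalar matrix c I,
   so "mat c ** M" is the scalar multiple c M. The type's own * and ^ are componentwise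
   and are not used on matrices. *)

primrec matrix_pochhammer :: "complex^'d^'d \<Rightarrow> nat \<Rightarrow> complex^'d^'d" where
  "matrix_pochhammer M 0 = mat 1"
| "matrix_pochhammer M (Suc n) = matrix_pochhammer M n ** (M + mat (of_nat n))"

(* At a negative index -n the value is meaningful only if (I - M)_n is invertible;
   matrix_inv is unspecified on singular matrices. *)
definition matrix_pochhammer_int :: "complex^'d^'d \<Rightarrow> int \<Rightarrow> complex^'d^'d" where
  "matrix_pochhammer_int M k =
     (if k \<ge> 0 then matrix_pochhammer M (nat k)
      else mat ((-1) ^ nat (-k)) ** matrix_inv (matrix_pochhammer (mat 1 - M) (nat (-k))))"

definition pochhammer_defined :: "complex^'d^'d \<Rightarrow> bool" where
  "pochhammer_defined M \<longleftrightarrow> (\<forall>n. invertible (matrix_pochhammer (mat 1 - M) n))"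

definition horn_G1_term ::
  "complex^'d^'d \<Rightarrow> complex^'d^'d \<Rightarrow> complex^'d^'d \<Rightarrow> complex \<Rightarrow> complex \<Rightarrow> nat \<Rightarrow> nat \<Rightarrow> complex^'d^'d" where
  "horn_G1_term A B B' x y m n =
     mat (x ^ m * y ^ n / (fact m * fact n)) **
       (matrix_pochhammer A (m + n)
        ** matrix_pochhammer_int B (int n - int m)
        ** matrix_pochhammer_int B' (int m - int n))"

end

theory Submission imports Defs "HOL-Real_Asymp.Real_Asymp" begin

text \<open>
  Opposite indices cancel: \<open>(B)\<^sub>n\<^sub>-\<^sub>m\<close> and \<open>(B')\<^sub>m\<^sub>-\<^sub>n\<close> have indices \<open>k\<close> and \<open>- k\<close>, so one of them is a
  product of \<open>\<bar>k\<bar>\<close> factors and the other the inverse of such a product. The first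
  is of order at most \<open>\<bar>k\<bar>!\<close> and the second of order at most \<open>1 / \<bar>k\<bar>!\<close>, in both cases up to
  a subexponential factor, and \<open>(A)\<^sub>m\<^sub>+\<^sub>n\<close> is of order at most \<open>(m + n)!\<close> in the same sense. Up to
  such factors, the terms of the series are therefore dominated by those of the double series of
  \<open>((m + n) choose m) * \<bar>x\<bar> ^ m * \<bar>y\<bar> ^ n\<close>, whose diagonals add up to the powers
  of \<open>\<bar>x\<bar> + \<bar>y\<bar>\<close>.

  Since \<open>\<bar>x\<bar> + \<bar>y\<bar> \<le> r + s < 1\<close> is strict, crude control of the subexponential factors
  suffices: each of the three symbols costs at most a constant times \<open>q ^ (m + n)\<close> for any
  chosen \<open>q > 1\<close>, and \<open>q\<close> can be taken so close to 1 that
  \<open>q ^ 3 * (\<bar>x\<bar> + \<bar>y\<bar>) < 1\<close>. The bounds for the symbols come from ratio estimates, in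
  \<open>norm_matrix_pochhammer_le\<close> and \<open>norm_matrix_inv_pochhammer_le\<close>; the comparison series is
  handled by \<open>summable_on_binomial_powers\<close>.
\<close>

section \<open>The Frobenius norm of complex matrices\<close>

lemma norm_matrix_sq:
  fixes A :: "complex^'n^'m"
  shows "(norm A)\<^sup>2 = (\<Sum>i\<in>UNIV. \<Sum>j\<in>UNIV. (norm (A $ i $ j))\<^sup>2)"
  by (simp add: norm_vec_def L2_set_def sum_nonneg)

text \<open>
  The norm of a matrix, read as a vector of rows, is the Frobenius norm. The Cauchy-Schwarz
  inequality for each entry of the product, squared and summed, makes it submultiplicative.
\<close>

lemma norm_matrix_mult_le:
  fixes A :: "complex^'n^'m" and B :: "complex^'p^'n"
  shows "norm (A ** B) \<le> norm A * norm B"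
proof -
  have entry: "(norm ((A ** B) $ i $ j))\<^sup>2
      \<le> (\<Sum>k\<in>UNIV. (norm (A $ i $ k))\<^sup>2) * (\<Sum>k\<in>UNIV. (norm (B $ k $ j))\<^sup>2)" for i j
  proof -
    have "norm ((A ** B) $ i $ j) \<le> (\<Sum>k\<in>UNIV. norm (A $ i $ k) * norm (B $ k $ j))"
      by (simp add: matrix_matrix_mult_def sum_norm_le norm_mult)
    then have "(norm ((A ** B) $ i $ j))\<^sup>2 \<le> (\<Sum>k\<in>UNIV. norm (A $ i $ k) * norm (B $ k $ j))\<^sup>2"
      by (rule power_mono) simp
    also have "\<dots> \<le> (\<Sum>k\<in>UNIV. (norm (A $ i $ k))\<^sup>2) * (\<Sum>k\<in>UNIV. (norm (B $ k $ j))\<^sup>2)"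
      by (rule Cauchy_Schwarz_ineq_sum)
    finally show ?thesis .
  qed
  have "(norm (A ** B))\<^sup>2 \<le> (\<Sum>i\<in>UNIV. \<Sum>j\<in>UNIV.
      (\<Sum>k\<in>UNIV. (norm (A $ i $ k))\<^sup>2) * (\<Sum>k\<in>UNIV. (norm (B $ k $ j))\<^sup>2))"
    unfolding norm_matrix_sq by (intro sum_mono entry)
  also have "\<dots> = (\<Sum>i\<in>UNIV. \<Sum>k\<in>UNIV. (norm (A $ i $ k))\<^sup>2)
      * (\<Sum>j\<in>UNIV. \<Sum>k\<in>UNIV. (norm (B $ k $ j))\<^sup>2)"
    by (simp add: sum_product)
  also have "(\<Sum>j\<in>UNIV. \<Sum>k\<in>UNIV. (norm (B $ k $ j))\<^sup>2) = (norm B)\<^sup>2"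
    unfolding norm_matrix_sq by (rule sum.swap)
  also have "(\<Sum>i\<in>UNIV. \<Sum>k\<in>UNIV. (norm (A $ i $ k))\<^sup>2) = (norm A)\<^sup>2"
    unfolding norm_matrix_sq ..
  finally have "(norm (A ** B))\<^sup>2 \<le> (norm A * norm B)\<^sup>2"
    by (simp add: power_mult_distrib)
  then show ?thesis
    by (rule power2_le_imp_le) simp
qed

lemma mat_matrix_mult_nth:
  fixes A :: "complex^'n^'m"
  shows "(mat c ** A) $ i $ j = c * A $ i $ j"
  by (simp add: matrix_matrix_mult_def mat_def if_distrib[of "\<lambda>u. u * _"] cong: if_cong)

lemma matrix_mult_mat_nth:
  fixes A :: "complex^'n^'m"
  shows "(A ** mat c) $ i $ j = c * A $ i $ j"
  by (simp add: matrix_matrix_mult_def mat_def if_distrib[of "\<lambda>u. _ * u"] cong: if_cong)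

text \<open>
  Scalar matrices need an exact factor. Submultiplicativity alone would cost a factor
  \<open>norm (mat 1) = sqrt d\<close> at each of the \<open>n\<close> multiplications that build a Pochhammer
  product, which would ruin its growth rate.
\<close>

lemma norm_mat_matrix_mult:
  fixes A :: "complex^'n^'m"
  shows "norm (mat c ** A) = norm c * norm A"
proof -
  have "(norm (mat c ** A))\<^sup>2 = (norm c * norm A)\<^sup>2"
    by (simp add: norm_matrix_sq mat_matrix_mult_nth norm_mult power_mult_distrib sum_distrib_left)
  then show ?thesis
    by (simp add: power2_eq_iff_nonneg)
qed

lemma norm_matrix_mult_mat:
  fixes A :: "complex^'n^'m"
  shows "norm (A ** mat c) = norm c * norm A"
proof -
  have "A ** mat c = mat c ** A"
    by (simp add: vec_eq_iff mat_matrix_mult_nth matrix_mult_mat_nth)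
  then show ?thesis
    by (simp add: norm_mat_matrix_mult)
qed

section \<open>Growth of matrix Pochhammer symbols\<close>

text \<open>
  Past some index \<open>N\<close> the quotients \<open>u n / q ^ n\<close> no longer increase, so their values up to
  \<open>N\<close>, here simply added up, bound all of them.
\<close>

lemma geometric_bound_if_eventually_ratio_le:
  fixes u :: "nat \<Rightarrow> real"
  assumes "q > 0" and "eventually (\<lambda>n. u (Suc n) \<le> q * u n) sequentially"
  obtains K where "K \<ge> 0" "\<And>n. u n \<le> K * q ^ n"
proof -
  obtain N where N: "\<And>n. n \<ge> N \<Longrightarrow> u (Suc n) \<le> q * u n"
    using assms(2) by (auto simp: eventually_sequentially)
  define K where "K = (\<Sum>n\<le>N. \<bar>u n\<bar> / q ^ n)"
  have K0: "K \<ge> 0"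
    unfolding K_def using \<open>q > 0\<close> by (intro sum_nonneg) simp
  have small: "u n \<le> K * q ^ n" if "n \<le> N" for n
  proof -
    have "\<bar>u n\<bar> / q ^ n \<le> K"
      unfolding K_def using that \<open>q > 0\<close>
      by (intro member_le_sum[where f = "\<lambda>n. \<bar>u n\<bar> / q ^ n"]) auto
    then show ?thesis
      using \<open>q > 0\<close> by (simp add: divide_le_eq)
  qed
  have "u n \<le> K * q ^ n" if "n \<ge> N" for n
    using that
  proof (induction n rule: dec_induct)
    case (step n)
    have "u (Suc n) \<le> q * u n" using N step by simp
    also have "\<dots> \<le> q * (K * q ^ n)" using step \<open>q > 0\<close> by simp
    finally show ?case by (simp add: mult_ac)
  qed (simp add: small)
  with small that K0 show thesis
    by (meson nle_le)
qed

text \<open>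
  Splitting the last factor \<open>A + n I\<close> shows that the norm grows by at most
  \<open>norm A + n\<close>, which is \<open>n + 1\<close> up to a factor tending to 1.
\<close>

lemma norm_matrix_pochhammer_le:
  fixes A :: "complex^'d^'d" and q :: real
  assumes "q > 1"
  obtains K where "K \<ge> 0" "\<And>n. norm (matrix_pochhammer A n) \<le> K * q ^ n * fact n"
proof -
  let ?P = "matrix_pochhammer A"
  have lim: "eventually (\<lambda>n. (norm A + real n) / real (Suc n) < q) sequentially"
  proof (rule order_tendstoD(2))
    show "(\<lambda>n. (norm A + real n) / real (Suc n)) \<longlonglongrightarrow> 1"
      by real_asymp
  qed (rule assms)
  have "eventually (\<lambda>n. norm (?P (Suc n)) / fact (Suc n) \<le> q * (norm (?P n) / fact n)) sequentially"
    using lim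
  proof eventually_elim
    case (elim n)
    have "norm (?P (Suc n)) \<le> norm (?P n ** A) + norm (?P n ** mat (of_nat n))"
      by (simp add: matrix_add_ldistrib norm_triangle_ineq)
    also have "\<dots> \<le> norm (?P n) * (norm A + real n)"
      using norm_matrix_mult_le[of "?P n" A] by (simp add: norm_matrix_mult_mat algebra_simps)
    finally have "norm (?P (Suc n)) / fact (Suc n) \<le> norm (?P n) * (norm A + real n) / fact (Suc n)"
      by (rule divide_right_mono) simp
    also have "\<dots> = (norm A + real n) / real (Suc n) * (norm (?P n) / fact n)"
      by simp
    also have "\<dots> \<le> q * (norm (?P n) / fact n)"
      using elim by (intro mult_right_mono) simp_all
    finally show ?case .
  qed
  with assms obtain K where "K \<ge> 0" and K: "\<And>n. norm (?P n) / fact n \<le> K * q ^ n"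
    by (elim geometric_bound_if_eventually_ratio_le[rotated]) auto
  with that show thesis
    by (simp add: divide_le_eq)
qed

lemma matrix_inv_inverse:
  fixes A :: "'a::semiring_1^'n^'m"
  assumes "invertible A"
  shows "A ** matrix_inv A = mat 1" "matrix_inv A ** A = mat 1"
  using someI_ex[OF assms[unfolded invertible_def]] unfolding matrix_inv_def by auto

text \<open>
  Multiplying \<open>P\<^sub>n\<^sub>+\<^sub>1 = P\<^sub>n (M + n I)\<close> by the inverse of \<open>P\<^sub>n\<^sub>+\<^sub>1\<close> on the right and by that of
  \<open>P\<^sub>n\<close> on the left expresses each inverse through the next one.
\<close>

lemma matrix_inv_pochhammer_step:
  fixes M :: "complex^'d^'d"
  assumes "invertible (matrix_pochhammer M n)" "invertible (matrix_pochhammer M (Suc n))"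
  shows "matrix_inv (matrix_pochhammer M n)
    = (M + mat (of_nat n)) ** matrix_inv (matrix_pochhammer M (Suc n))"
proof -
  let ?P = "matrix_pochhammer M" and ?S = "M + mat (of_nat n)"
  have "?P n ** (?S ** matrix_inv (?P (Suc n))) = mat 1"
    using matrix_inv_inverse(1)[OF assms(2)] by (simp add: matrix_mul_assoc)
  then have "matrix_inv (?P n) ** (?P n ** (?S ** matrix_inv (?P (Suc n)))) = matrix_inv (?P n)"
    by simp
  then show ?thesis
    by (simp add: matrix_mul_assoc matrix_inv_inverse(2)[OF assms(1)])
qed

lemma matrix_mult_add_left_distrib:
  fixes A B :: "'a::semiring_1^'n^'m"
  shows "(A + B) ** C = A ** C + B ** C"
  by (simp add: vec_eq_iff matrix_matrix_mult_def sum.distrib distrib_right)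

text \<open>
  With \<open>R\<^sub>n\<close> the inverse of the Pochhammer product, \<open>R\<^sub>n = (M + n I) R\<^sub>n\<^sub>+\<^sub>1\<close> gives
  \<open>norm R\<^sub>n \<ge> (n - norm M) * norm R\<^sub>n\<^sub>+\<^sub>1\<close>. So, once \<open>n > norm M\<close>, the inverses shrink at the
  rate \<open>1 / (n - norm M)\<close>, which is \<open>1 / (n + 1)\<close> up to a factor tending to 1.
\<close>

lemma norm_matrix_inv_pochhammer_le:
  fixes M :: "complex^'d^'d" and q :: real
  assumes inv: "\<And>n. invertible (matrix_pochhammer M n)" and "q > 1"
  obtains K where "K \<ge> 0" "\<And>n. norm (matrix_inv (matrix_pochhammer M n)) \<le> K * q ^ n / fact n"
proof -
  define R where "R n = matrix_inv (matrix_pochhammer M n)" for n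
  have lim: "eventually (\<lambda>n. real (Suc n) / (real n - norm M) < q) sequentially"
  proof (rule order_tendstoD(2))
    show "(\<lambda>n. real (Suc n) / (real n - norm M)) \<longlonglongrightarrow> 1"
      by real_asymp
  qed (rule assms)
  have pos: "eventually (\<lambda>n. real n > norm M) sequentially"
    by real_asymp
  have "eventually (\<lambda>n. norm (R (Suc n)) * fact (Suc n) \<le> q * (norm (R n) * fact n)) sequentially"
    using lim pos
  proof eventually_elim
    case (elim n)
    have R: "R n = M ** R (Suc n) + mat (of_nat n) ** R (Suc n)"
      using matrix_inv_pochhammer_step[OF inv inv, of n]
      by (simp add: R_def matrix_mult_add_left_distrib)
    have "real n * norm (R (Suc n)) = norm (R n - M ** R (Suc n))"
      by (simp add: R norm_mat_matrix_mult)
    also have "\<dots> \<le> norm (R n) + norm M * norm (R (Suc n))"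
      by (rule order_trans[OF norm_triangle_ineq4]) (simp add: norm_matrix_mult_le)
    finally have "norm (R (Suc n)) \<le> norm (R n) / (real n - norm M)"
      using elim by (simp add: field_simps)
    then have "norm (R (Suc n)) * fact (Suc n) \<le> norm (R n) / (real n - norm M) * fact (Suc n)"
      by (rule mult_right_mono) simp
    also have "\<dots> = real (Suc n) / (real n - norm M) * (norm (R n) * fact n)"
      by simp
    also have "\<dots> \<le> q * (norm (R n) * fact n)"
      using elim by (intro mult_right_mono) simp_all
    finally show ?case .
  qed
  with assms obtain K where "K \<ge> 0" and K: "\<And>n. norm (R n) * fact n \<le> K * q ^ n"
    by (elim geometric_bound_if_eventually_ratio_le[rotated]) auto
  with that show thesis
    by (simp add: R_def pos_le_divide_eq)
qed

lemma matrix_pochhammer_int_nonneg: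
  "matrix_pochhammer_int M (int n) = matrix_pochhammer M n"
  by (simp add: matrix_pochhammer_int_def)

lemma norm_matrix_pochhammer_int_nonpos:
  "norm (matrix_pochhammer_int M (- int n)) = norm (matrix_inv (matrix_pochhammer (mat 1 - M) n))"
proof (cases "n = 0")
  \<comment> \<open>Index 0 falls under the first clause of the definition, with value \<open>mat 1\<close>, its own inverse.\<close>
  case True
  have "matrix_inv (mat 1 :: complex^'a^'a) = mat 1"
    using matrix_inv_inverse(1)[of "mat 1 :: complex^'a^'a"] by (simp add: invertible_def)
  with True show ?thesis
    by (simp add: matrix_pochhammer_int_def)
next
  case False
  then show ?thesis
    by (simp add: matrix_pochhammer_int_def norm_mat_matrix_mult norm_power)
qed

text \<open>
  The factorial growth of the symbol at index \<open>n\<close> is cancelled by the factorial decay of the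
  symbol at index \<open>- n\<close>.
\<close>

lemma norm_opposite_pochhammer_le:
  fixes B C :: "complex^'d^'d" and q :: real
  assumes "pochhammer_defined C" and "q > 1"
  obtains K where "K \<ge> 0"
    "\<And>n. norm (matrix_pochhammer_int B (int n)) * norm (matrix_pochhammer_int C (- int n)) \<le> K * (q ^ n)\<^sup>2"
proof -
  obtain K where K: "K \<ge> 0" "\<And>n. norm (matrix_pochhammer B n) \<le> K * q ^ n * fact n"
    using norm_matrix_pochhammer_le assms by blast
  obtain L where L: "L \<ge> 0"
      "\<And>n. norm (matrix_inv (matrix_pochhammer (mat 1 - C) n)) \<le> L * q ^ n / fact n"
    using norm_matrix_inv_pochhammer_le assms unfolding pochhammer_defined_def by metis
  show thesis
  proof
    fix n
    have "norm (matrix_pochhammer_int B (int n)) * norm (matrix_pochhammer_int C (- int n))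
        \<le> (K * q ^ n * fact n) * (L * q ^ n / fact n)"
      unfolding matrix_pochhammer_int_nonneg norm_matrix_pochhammer_int_nonpos
      using K L \<open>q > 1\<close> by (intro mult_mono) auto
    then show "norm (matrix_pochhammer_int B (int n)) * norm (matrix_pochhammer_int C (- int n))
        \<le> (K * L) * (q ^ n)\<^sup>2"
      by (simp add: power2_eq_square mult_ac)
  qed (use K L in simp)
qed

section \<open>Convergence of the double series\<close>

text \<open>
  On the diagonal \<open>m + n = k\<close> the terms add up to \<open>(X + Y) ^ k\<close> by the binomial theorem, and
  these diagonal sums form a convergent geometric series. As all terms are nonnegative, bounding
  the sums over finite triangles is enough.
\<close>

lemma summable_on_binomial_powers:
  fixes X Y :: real
  assumes "X \<ge> 0" "Y \<ge> 0" "X + Y < 1"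
  shows "(\<lambda>(m, n). real ((m + n) choose m) * X ^ m * Y ^ n) summable_on UNIV"
proof (rule nonneg_bdd_above_summable_on)
  let ?f = "\<lambda>m n. real ((m + n) choose m) * X ^ m * Y ^ n"
  show "0 \<le> (case p of (m, n) \<Rightarrow> ?f m n)" for p
    using assms by (auto split: prod.split)
  show "bdd_above (sum (\<lambda>(m, n). ?f m n) ` {F. F \<subseteq> UNIV \<and> finite F})"
  proof (rule bdd_aboveI2)
    fix F :: "(nat \<times> nat) set"
    assume "F \<in> {F. F \<subseteq> UNIV \<and> finite F}"
    then have "finite F" by simp
    then obtain N where N: "\<And>p. p \<in> F \<Longrightarrow> fst p + snd p \<le> N"
      using finite_nat_set_iff_bounded_le[of "(\<lambda>p. fst p + snd p) ` F"] by auto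
    have "finite {(i, j). i + j \<le> N}"
      by (rule finite_subset[of _ "{..N} \<times> {..N}"]) auto
    then have "(\<Sum>(m, n)\<in>F. ?f m n) \<le> (\<Sum>(m, n) | m + n \<le> N. ?f m n)"
      using N assms by (intro sum_mono2) force+
    also have "\<dots> = (\<Sum>k\<le>N. \<Sum>m\<le>k. ?f m (k - m))"
      by (rule sum.triangle_reindex_eq)
    also have "\<dots> = (\<Sum>k\<le>N. (X + Y) ^ k)"
      by (simp add: binomial_ring)
    also have "\<dots> \<le> (\<Sum>k. (X + Y) ^ k)"
      using assms by (intro sum_le_suminf summable_geometric) auto
    finally show "(\<Sum>(m, n)\<in>F. ?f m n) \<le> (\<Sum>k. (X + Y) ^ k)" .
  qed
qed

theorem theorem3p1:
  fixes A B B' :: "complex^'d^'d" and x y :: complex and r s :: real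
  assumes "pochhammer_defined B" and "pochhammer_defined B'"
    and "r + s < 1" and "norm x \<le> r" and "norm y \<le> s"
  shows "(\<lambda>(m, n). norm (horn_G1_term A B B' x y m n)) summable_on (UNIV :: (nat \<times> nat) set)"
proof -
  have t: "norm x + norm y < 1" using assms by simp
  have "eventually (\<lambda>q. q ^ 3 * (norm x + norm y) < 1) (at_right (1::real))"
  proof (rule order_tendstoD(2)[OF _ t])
    have "((\<lambda>q. q ^ 3 * (norm x + norm y)) \<longlongrightarrow> 1 ^ 3 * (norm x + norm y)) (at_right (1::real))"
      by (intro tendsto_intros)
    then show "((\<lambda>q. q ^ 3 * (norm x + norm y)) \<longlongrightarrow> norm x + norm y) (at_right (1::real))"
      by simp
  qed
  then have "eventually (\<lambda>q. q > 1 \<and> q ^ 3 * (norm x + norm y) < 1) (at_right (1::real))"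
    by (intro eventually_conj eventually_at_right_less)
  then obtain q :: real where q: "q > 1" "q ^ 3 * (norm x + norm y) < 1"
    using eventually_happens by force
  obtain a where a: "a \<ge> 0" "\<And>n. norm (matrix_pochhammer A n) \<le> a * q ^ n * fact n"
    using norm_matrix_pochhammer_le q(1) by blast
  obtain b where b: "b \<ge> 0" "\<And>n. norm (matrix_pochhammer_int B (int n))
      * norm (matrix_pochhammer_int B' (- int n)) \<le> b * (q ^ n)\<^sup>2"
    using norm_opposite_pochhammer_le assms(2) q(1) by blast
  obtain c where c: "c \<ge> 0" "\<And>n. norm (matrix_pochhammer_int B' (int n))
      * norm (matrix_pochhammer_int B (- int n)) \<le> c * (q ^ n)\<^sup>2"
    using norm_opposite_pochhammer_le assms(1) q(1) by blast
  \<comment> \<open>The sign of \<open>n - m\<close> decides which symbol is inverted; \<open>b + c\<close> covers both cases, and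
    \<open>\<bar>n - m\<bar> \<le> m + n\<close>.\<close>
  have BB': "norm (matrix_pochhammer_int B (int n - int m)) * norm (matrix_pochhammer_int B' (int m - int n))
      \<le> (b + c) * (q ^ (m + n))\<^sup>2" for m n
  proof -
    have mono: "z * (q ^ k)\<^sup>2 \<le> (b + c) * (q ^ (m + n))\<^sup>2" if "z = b \<or> z = c" "k \<le> m + n" for z k
    proof (intro mult_mono power_mono)
      show "q ^ k \<le> q ^ (m + n)" using q that by simp
    qed (use that b c q in auto)
    show ?thesis
    proof (cases "m \<le> n")
      case True
      then show ?thesis
        using order_trans[OF b(2)[of "n - m"] mono] by simp
    next
      case False
      then show ?thesis
        using order_trans[OF c(2)[of "m - n"] mono] by (simp add: mult.commute)
    qed
  qed
  define X Y where "X = q ^ 3 * norm x" and "Y = q ^ 3 * norm y"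
  have "norm (horn_G1_term A B B' x y m n)
      \<le> a * (b + c) * (real ((m + n) choose m) * X ^ m * Y ^ n)" for m n
  proof -
    let ?P = "matrix_pochhammer A (m + n)"
    let ?B = "matrix_pochhammer_int B (int n - int m)"
    let ?B' = "matrix_pochhammer_int B' (int m - int n)"
    let ?w = "norm x ^ m * norm y ^ n / (fact m * fact n)"
    have "norm (?P ** ?B ** ?B') \<le> norm ?P * norm ?B * norm ?B'"
      by (meson norm_matrix_mult_le mult_right_mono norm_ge_zero order_trans)
    also have "\<dots> = norm ?P * (norm ?B * norm ?B')"
      by simp
    also have "\<dots> \<le> (a * q ^ (m + n) * fact (m + n)) * ((b + c) * (q ^ (m + n))\<^sup>2)"
      using a q by (intro mult_mono a(2) BB') auto
    finally have "?w * norm (?P ** ?B ** ?B')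
        \<le> ?w * ((a * q ^ (m + n) * fact (m + n)) * ((b + c) * (q ^ (m + n))\<^sup>2))"
      by (rule mult_left_mono) simp
    also have "\<dots> = a * (b + c) * (fact (m + n) / (fact m * fact n))
        * (q ^ (m + n) * (q ^ (m + n))\<^sup>2) * (norm x ^ m * norm y ^ n)"
      by (simp add: field_simps)
    also have "fact (m + n) / (fact m * fact n) = real ((m + n) choose m)"
      by (simp add: binomial_fact)
    also have "q ^ (m + n) * (q ^ (m + n))\<^sup>2 = (q ^ 3) ^ m * (q ^ 3) ^ n"
      by (simp add: power_add power_mult[symmetric] power2_eq_square power3_eq_cube power_mult_distrib)
    finally show ?thesis
      by (simp add: horn_G1_term_def norm_mat_matrix_mult norm_mult norm_divide norm_power
          X_def Y_def power_mult_distrib mult_ac)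
  qed
  moreover have "(\<lambda>(m, n). a * (b + c) * (real ((m + n) choose m) * X ^ m * Y ^ n)) summable_on UNIV"
    using summable_on_cmult_right[OF summable_on_binomial_powers[of X Y], of "a * (b + c)"] q
    by (simp add: X_def Y_def case_prod_unfold distrib_left)
  ultimately show ?thesis
    by (elim summable_on_comparison_test) auto
qed
end
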